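(* If $G$ is a connected graph and $uwv$ is a path in $G$ (so $uw,wv\in E(G)$ with $u,w,v$ distinct), then $b_{dR}(G)\leq \deg_G(u)+\deg_G(v)-1$.
   Context: All graphs are finite, simple and undirected; $\deg_G(v)$ is the degree of $v$. For a graph $G=(V,E)$, a double Roman dominating function (DRDF) is a function $f:V\to\{0,1,2,3\}$ such that every vertex $v$ with $f(v)=0$ has at least two neighbors $u$ with $f(u)=2$ or at least one neighbor $w$ with $f(w)=3$, and every vertex $v$ with $f(v)=1$ has at least one neighbor $w$ with $f(w)\geq 2$. The weight of $f$ is $\sum_{u\in V}f(u)$, and $\gamma_{dR}(G)$ is the minimum weight of a DRDF on $G$. The double Roman bondage number $b_{dR}(G)$ is the minimum cardinality of an edge set $B\subseteq E(G)$ such that $\gamma_{dR}(G-B)>\gamma_{dR}(G)$. *)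

theory Defs
  imports Main "HOL-Library.FuncSet" "HOL-Library.Extended_Nat"
begin

definition simple_graph :: "'a set \<Rightarrow> 'a set set \<Rightarrow> bool" where
  "simple_graph V E \<longleftrightarrow> finite V \<and> (\<forall>e\<in>E. e \<subseteq> V \<and> card e = 2)"

definition neighbors :: "'a set set \<Rightarrow> 'a \<Rightarrow> 'a set" where
  "neighbors E v = {u. {v, u} \<in> E}"

definition degree :: "'a set set \<Rightarrow> 'a \<Rightarrow> nat" where
  "degree E v = card (neighbors E v)"

definition connected_graph :: "'a set \<Rightarrow> 'a set set \<Rightarrow> bool" where
  "connected_graph V E \<longleftrightarrow>
     V \<noteq> {} \<and> (\<forall>x\<in>V. \<forall>y\<in>V. (x, y) \<in> {(a, b). {a, b} \<in> E}\<^sup>*)"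

definition is_DRDF :: "'a set \<Rightarrow> 'a set set \<Rightarrow> ('a \<Rightarrow> nat) \<Rightarrow> bool" where
  "is_DRDF V E f \<longleftrightarrow>
     f \<in> V \<rightarrow> {0, 1, 2, 3} \<and>
     (\<forall>v\<in>V. f v = 0 \<longrightarrow>
        card {u \<in> neighbors E v. f u = 2} \<ge> 2 \<or> (\<exists>w\<in>neighbors E v. f w = 3)) \<and>
     (\<forall>v\<in>V. f v = 1 \<longrightarrow> (\<exists>w\<in>neighbors E v. f w \<ge> 2))"

definition weight :: "'a set \<Rightarrow> ('a \<Rightarrow> nat) \<Rightarrow> nat" where
  "weight V f = (\<Sum>u\<in>V. f u)"

definition gamma_dR :: "'a set \<Rightarrow> 'a set set \<Rightarrow> nat" where
  "gamma_dR V E = (LEAST k. \<exists>f. is_DRDF V E f \<and> weight V f = k)"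

lemma is_DRDF_const_2: "is_DRDF V E (\<lambda>_. 2)"
  by (simp add: is_DRDF_def)

lemma gamma_dR_attained: "\<exists>f. is_DRDF V E f \<and> weight V f = gamma_dR V E"
  unfolding gamma_dR_def by (rule LeastI_ex) (use is_DRDF_const_2 in blast)

lemma gamma_dR_le: "is_DRDF V E f \<Longrightarrow> gamma_dR V E \<le> weight V f"
  unfolding gamma_dR_def by (rule Least_le) blast

(* Valued in enat so that the minimum over an empty family of edge sets, which occurs
   e.g. for edgeless graphs, is infinite instead of an arbitrary number. *)
definition b_dR :: "'a set \<Rightarrow> 'a set set \<Rightarrow> enat" where
  "b_dR V E = (INF B \<in> {B. B \<subseteq> E \<and> gamma_dR V (E - B) > gamma_dR V E}. enat (card B))"

end

theory Submission imports Defs begin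

text \<open>
  Delete all edges at \<open>u\<close> or \<open>v\<close> except \<open>wv\<close>. In the remaining graph \<open>u\<close> is isolated and \<open>v\<close> is a
  leaf attached to \<open>w\<close>, so every DRDF puts weight at least 2 on \<open>u\<close> and at least 2 on \<open>{v, w}\<close>.
  Assigning 0, 0, 3 to \<open>u, v, w\<close> instead yields a DRDF of the original graph of smaller weight,
  since in the remaining graph no vertex other than \<open>w\<close> is defended by \<open>u\<close> or \<open>v\<close>.
\<close>

lemma neighbors_sym: "x \<in> neighbors E y \<longleftrightarrow> y \<in> neighbors E x"
  by (simp add: neighbors_def insert_commute)

lemma neighbors_mono: "F \<subseteq> E \<Longrightarrow> neighbors F x \<subseteq> neighbors E x"
  by (auto simp: neighbors_def)

lemma finite_neighbors:
  assumes "simple_graph V E"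
  shows "finite (neighbors E x)"
proof (rule finite_subset)
  show "neighbors E x \<subseteq> V"
    using assms by (auto simp: simple_graph_def neighbors_def)
  show "finite V"
    using assms by (simp add: simple_graph_def)
qed

lemma edge_eq_insert_neighbor:
  assumes "simple_graph V E" "e \<in> E" "x \<in> e"
  obtains y where "y \<in> neighbors E x" "e = {x, y}"
proof -
  have "card e = 2"
    using assms by (simp add: simple_graph_def)
  then obtain y where "e = {x, y}"
    using assms(3) by (auto simp: card_2_iff)
  with assms(2) show thesis
    by (intro that) (auto simp: neighbors_def)
qed

lemma is_DRDF_isolated_ge_2:
  assumes "is_DRDF V E f" "x \<in> V" "neighbors E x = {}"
  shows "f x \<ge> 2"
proof -
  have "f x \<noteq> 0" "f x \<noteq> 1"
    using assms by (auto simp: is_DRDF_def)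
  then show ?thesis by linarith
qed

text \<open>A single neighbor cannot supply two values 2, so the value 0 at \<open>x\<close> forces
  3 at \<open>y\<close>, and the value 1 at \<open>x\<close> forces at least 2 there.\<close>

lemma is_DRDF_leaf_ge_2:
  assumes "is_DRDF V E f" "x \<in> V" "neighbors E x \<subseteq> {y}"
  shows "f x + f y \<ge> 2"
proof -
  have "card {z \<in> neighbors E x. f z = 2} \<le> card {y}"
    using assms(3) by (intro card_mono) auto
  then have "f x = 0 \<longrightarrow> f y = 3" "f x = 1 \<longrightarrow> f y \<ge> 2"
    using assms by (fastforce simp: is_DRDF_def)+
  then show ?thesis by linarith
qed

text \<open>In \<open>E\<close> the value 3 at \<open>w\<close> defends all neighbors of
  \<open>w\<close>, in particular \<open>u\<close> and \<open>v\<close>. Every other vertex relies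
  on its old defenders in \<open>F\<close>, which are still its neighbors in
  \<open>E\<close>.\<close>

lemma is_DRDF_shift_to_common_neighbor:
  assumes f: "is_DRDF V F f" and "F \<subseteq> E" and fin: "\<And>x. finite (neighbors E x)"
    and u: "neighbors F u = {}" and v: "neighbors F v \<subseteq> {w}"
    and wu: "w \<in> neighbors E u" and wv: "w \<in> neighbors E v" and ne: "u \<noteq> w" "v \<noteq> w"
  shows "is_DRDF V E (f(u := 0, v := 0, w := 3))" (is "is_DRDF V E ?g")
proof -
  have mono: "neighbors F x \<subseteq> neighbors E x" for x
    using \<open>F \<subseteq> E\<close> by (rule neighbors_mono)
  \<comment> \<open>Adjacency is symmetric: if \<open>y\<close> were \<open>u\<close> or
    \<open>v\<close>, then \<open>x\<close> would be an \<open>F\<close>-neighbor of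
    \<open>u\<close> or \<open>v\<close>, which only \<open>w\<close> can be.\<close>
  have away: "y \<noteq> u \<and> y \<noteq> v" if "x \<noteq> w" "y \<in> neighbors F x" for x y
    using that u v neighbors_sym[of y F x] by auto
  have g_range: "?g \<in> V \<rightarrow> {0, 1, 2, 3}"
    using f by (auto simp: is_DRDF_def Pi_iff)
  have g0: "card {y \<in> neighbors E x. ?g y = 2} \<ge> 2 \<or> (\<exists>y\<in>neighbors E x. ?g y = 3)"
    if x: "x \<in> V" "?g x = 0" for x
  proof (cases "w \<in> neighbors E x")
    case True
    then show ?thesis by (intro disjI2 bexI[of _ w]) auto
  next
    case False
    then have xne: "x \<noteq> u" "x \<noteq> v" "x \<noteq> w"
      using wu wv x(2) by auto
    then have "f x = 0" using x(2) by simp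
    then consider "card {y \<in> neighbors F x. f y = 2} \<ge> 2" | y where "y \<in> neighbors F x" "f y = 3"
      using f x(1) by (auto simp: is_DRDF_def)
    then show ?thesis
    proof cases
      case 1
      \<comment> \<open>Raising \<open>w\<close> from 2 to 3 could remove it from the set of
        neighbors of value 2, but in this case \<open>w\<close> is not adjacent to
        \<open>x\<close>.\<close>
      have "{y \<in> neighbors F x. f y = 2} \<subseteq> {y \<in> neighbors E x. ?g y = 2}"
        using away[OF xne(3)] mono[of x] False by auto
      from card_mono[OF _ this] 1 show ?thesis using fin[of x] by simp
    next
      case 2
      then have "?g y = 3" "y \<in> neighbors E x"
        using away[OF xne(3)] mono[of x] by auto
      then show ?thesis by blast
    qed
  qed
  have g1: "\<exists>y\<in>neighbors E x. ?g y \<ge> 2" if x: "x \<in> V" "?g x = 1" for x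
  proof -
    have xne: "x \<noteq> w" and "f x = 1"
      using x(2) by (auto split: if_splits)
    then obtain y where y: "y \<in> neighbors F x" "f y \<ge> 2"
      using f x(1) by (auto simp: is_DRDF_def)
    \<comment> \<open>The defender \<open>y\<close> may be \<open>w\<close> itself; its new value 3
      still suffices.\<close>
    then have "?g y \<ge> 2" "y \<in> neighbors E x"
      using away[OF xne] mono[of x] by auto
    then show ?thesis by blast
  qed
  show ?thesis
    unfolding is_DRDF_def using g_range g0 g1 by blast
qed

lemma weight_three_split:
  assumes "finite V" "u \<in> V" "v \<in> V" "w \<in> V" "distinct [u, w, v]"
  shows "weight V f = f u + f v + f w + sum f (V - {u, v, w})"
proof -
  have "sum f V = sum f (V - {u, v, w}) + sum f {u, v, w}"
    using assms by (intro sum.subset_diff) auto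
  then show ?thesis
    using assms(5) by (auto simp: weight_def)
qed

theorem theorem3p7:
  fixes V :: "'a set" and E :: "'a set set" and u w v :: 'a
  assumes "simple_graph V E"
    and "connected_graph V E"
    and "{u, w} \<in> E" and "{w, v} \<in> E"
    and "distinct [u, w, v]"
  shows "b_dR V E \<le> enat (degree E u + degree E v - 1)"
proof -
  have ne: "u \<noteq> w" "v \<noteq> w" "u \<noteq> v"
    using assms(5) by auto
  have finV: "finite V" and inV: "u \<in> V" "v \<in> V" "w \<in> V"
    using assms(1,3,4) by (auto simp: simple_graph_def)
  note fin = finite_neighbors[OF assms(1)]
  have wu: "w \<in> neighbors E u" and wv: "w \<in> neighbors E v"
    using assms(3,4) by (auto simp: neighbors_def insert_commute)
  define B where "B = {e \<in> E. (u \<in> e \<or> v \<in> e) \<and> e \<noteq> {w, v}}"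
  have Nu: "neighbors (E - B) u = {}" and Nv: "neighbors (E - B) v \<subseteq> {w}"
    using ne by (auto simp: B_def neighbors_def doubleton_eq_iff)

  \<comment> \<open>The edge \<open>{w, v}\<close> stays, so \<open>w\<close> is left out among the
    neighbors of \<open>v\<close>; this gives the -1 in the bound. A possible edge
    \<open>{u, v}\<close> is counted twice, which is harmless for an upper bound.\<close>
  have "B \<subseteq> (\<lambda>x. {u, x}) ` neighbors E u \<union> (\<lambda>x. {v, x}) ` (neighbors E v - {w})"
  proof
    fix e assume e: "e \<in> B"
    then have eE: "e \<in> E" and "e \<noteq> {w, v}" and "u \<in> e \<or> v \<in> e"
      by (auto simp: B_def)
    from \<open>u \<in> e \<or> v \<in> e\<close>
    show "e \<in> (\<lambda>x. {u, x}) ` neighbors E u \<union> (\<lambda>x. {v, x}) ` (neighbors E v - {w})"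
    proof
      assume "u \<in> e"
      from edge_eq_insert_neighbor[OF assms(1) eE this] show ?thesis by blast
    next
      assume "v \<in> e"
      from edge_eq_insert_neighbor[OF assms(1) eE this]
      obtain y where "y \<in> neighbors E v" "e = {v, y}" .
      with \<open>e \<noteq> {w, v}\<close> show ?thesis by (auto simp: insert_commute)
    qed
  qed
  then have "card B \<le> card ((\<lambda>x. {u, x}) ` neighbors E u \<union> (\<lambda>x. {v, x}) ` (neighbors E v - {w}))"
    by (rule card_mono[rotated]) (simp add: fin)
  also have "\<dots> \<le> card (neighbors E u) + card (neighbors E v - {w})"
    by (intro order_trans[OF card_Un_le] add_mono card_image_le) (simp_all add: fin)
  \<comment> \<open>\<open>w\<close> is a neighbor of \<open>v\<close>, so the degree of
    \<open>v\<close> is positive and the truncated subtraction on naturals is exact.\<close>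
  also have "\<dots> = degree E u + degree E v - 1"
    using wv fin[of v] card_gt_0_iff[of "neighbors E v"] by (auto simp: degree_def)
  finally have card_B: "card B \<le> degree E u + degree E v - 1" .

  obtain f where f: "is_DRDF V (E - B) f" and wf: "weight V f = gamma_dR V (E - B)"
    using gamma_dR_attained by blast
  define g where "g = f(u := 0, v := 0, w := 3)"
  have "is_DRDF V E g"
    unfolding g_def
    by (rule is_DRDF_shift_to_common_neighbor[OF f _ fin Nu Nv wu wv ne(1,2)]) simp
  then have "gamma_dR V E \<le> weight V g"
    by (rule gamma_dR_le)
  also have "weight V g = 3 + sum f (V - {u, v, w})"
    using ne by (simp add: weight_three_split[OF finV inV assms(5)] g_def)
  \<comment> \<open>On \<open>u\<close>, \<open>v\<close> and \<open>w\<close> together,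
    \<open>f\<close> has weight at least 2 + 2 = 4, whereas \<open>g\<close> has weight 3; elsewhere
    they agree.\<close>
  also have "\<dots> < weight V f"
    using is_DRDF_isolated_ge_2[OF f inV(1) Nu] is_DRDF_leaf_ge_2[OF f inV(2) Nv]
    by (simp add: weight_three_split[OF finV inV assms(5)])
  finally have "gamma_dR V (E - B) > gamma_dR V E"
    using wf by simp
  moreover have "B \<subseteq> E"
    by (auto simp: B_def)
  ultimately have "b_dR V E \<le> enat (card B)"
    unfolding b_dR_def by (intro INF_lower) simp
  also have "\<dots> \<le> enat (degree E u + degree E v - 1)"
    using card_B by simp
  finally show ?thesis .
qed

end
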